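(* Let $\theta=(\theta(n))_{n\in\mathbb N}$ be a bounded sequence of complex numbers and let $u=(u_n)_{n\in\mathbb N}$ be a strictly increasing sequence of non-negative integers. Suppose that there are $\delta<1$ and a constant $C$ such that for all $N\ge 1$ $$\sup_{\alpha\in\mathbb R}\left|\sum_{k=0}^{N-1}\theta(k)e^{2i\pi\alpha u_k}\right|\le C N^{\delta}.$$ Then, for any dynamical system $(X,\mathcal B,\mu,T)$ and any $f\in L^2(\mu)$, $$\mu\left\{x\in X:\ \lim_{N\to+\infty}\frac1N\sum_{k=0}^{N-1}\theta(k)f(T^{u_k}x)=0\right\}=1.$$ Moreover, for any dynamical system $(X,\mathcal B,\mu,T)$, for all $\varepsilon>0$, all $f\in L^{2+\varepsilon}(\mu)$ and all $\beta>(\delta+2)/3$, $$\mu\left\{x\in X:\ \lim_{N\to+\infty}\frac1{N^{\beta}}\sum_{k=0}^{N-1}\theta(k)f(T^{u_k}x)=0\right\}=1.$$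
   Context: $\mathbb N=\{0,1,2,\dots\}$. A dynamical system $(X,\mathcal B,\mu,T)$ consists of a probability space $(X,\mathcal B,\mu)$ and a measurable map $T:X\to X$ such that $\mu$ is $T$-invariant. *)

theory Defs
  imports "HOL-Probability.Probability"
begin

locale dynamical_system = prob_space M for M :: "'a measure" +
  fixes T :: "'a \<Rightarrow> 'a"
  assumes measurable_T: "T \<in> measurable M M"
    and invariant_T: "\<And>A. A \<in> sets M \<Longrightarrow> emeasure M (T -` A \<inter> space M) = emeasure M A"

text \<open>Elements of \<open>L\<^sup>p\<close> are represented by functions, not by classes modulo null sets.\<close>

definition Lp :: "real \<Rightarrow> 'a measure \<Rightarrow> ('a \<Rightarrow> complex) set" where
  "Lp p M = {f \<in> borel_measurable M. integrable M (\<lambda>x. norm (f x) powr p)}"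

end

theory Submission imports Defs "HOL-Real_Asymp.Real_Asymp" begin

text \<open>
  For every polynomial \<open>P\<close>, the operator \<open>P(T)\<close> on \<open>L\<^sup>2\<close> has norm at most \<open>sup |P|\<close> over the unit circle.
  Hence the sum \<open>S\<^sub>N\<close> of the first \<open>N\<close> weighted terms satisfies \<open>\<parallel>S\<^sub>N\<parallel>\<^sub>2 \<le> C N\<^sup>\<delta> \<parallel>f\<parallel>\<^sub>2\<close>,
  while by boundedness of the weights a block of \<open>l\<close> consecutive terms has norm \<open>O(l)\<close>, even with
  absolute values inside. Cut the indices at \<open>N\<^sub>j = \<lceil>j\<^sup>p\<rceil>\<close> with \<open>p = 1/(1 - \<delta>)\<close>. Both \<open>S\<close> at \<open>N\<^sub>j\<close> and the
  absolute sum over the \<open>j\<close>-th block then have norm \<open>O(j\<^bsup>p-1\<^esup>)\<close>, so after division by \<open>j\<^bsup>p\<beta>\<^esup>\<close> their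
  squares are summable in expectation as soon as \<open>\<beta> > (1 + \<delta>)/2\<close>, and almost everywhere convergence
  to \<open>0\<close> follows. This covers \<open>\<beta> = 1\<close> and all \<open>\<beta> > (\<delta> + 2)/3\<close>. The choice of \<open>p\<close>
  needs \<open>\<delta> \<ge> 0\<close>; for \<open>\<delta> < 0\<close> the hypothesis forces \<open>\<theta> = 0\<close>.
\<close>

section \<open>Fourier analysis on the cyclic group of order \<open>Q\<close>, and
  transference\<close>

lemma sum_cis_roots_eq_0:
  fixes Q :: nat and d :: int
  assumes "Q > 0" "\<not> int Q dvd d"
  shows "(\<Sum>j<Q. cis (2 * pi * real j * of_int d / real Q)) = 0"
proof -
  define z where "z = cis (2 * pi * of_int d / real Q)"
  have zj: "cis (2 * pi * real j * of_int d / real Q) = z ^ j" for j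
    unfolding z_def Complex.DeMoivre by (simp add: mult_ac)
  have "z \<noteq> 1"
  proof
    assume "z = 1"
    then have "cos (2 * pi * of_int d / real Q) = 1"
      unfolding z_def by (simp add: complex_eq_iff)
    then obtain n :: int where "2 * pi * of_int d / real Q = of_int n * 2 * pi"
      by (auto simp: cos_one_2pi_int)
    then have "real_of_int d = of_int n * real Q"
      using assms(1) by (simp add: field_simps)
    then have "d = n * int Q"
      by (metis of_int_eq_iff of_int_mult of_int_of_nat_eq)
    then show False using assms(2) by simp
  qed
  moreover have "z ^ Q = 1"
    unfolding z_def Complex.DeMoivre using assms(1) cis_multiple_2pi[of "of_int d"] by simp
  ultimately show ?thesis
    unfolding zj by (simp add: geometric_sum)
qed

text \<open>Expanding the squares leaves sums of \<open>?e j n * cnj (?e j m)\<close> over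
  \<open>j\<close>, and orthogonality of the characters removes all terms with
  \<open>n \<noteq> m\<close>.\<close>

lemma finite_Parseval:
  fixes b :: "nat \<Rightarrow> complex"
  assumes "Q > 0"
  shows "(\<Sum>j<Q. (cmod (\<Sum>n<Q. b n * cis (2 * pi * real j * real n / real Q)))\<^sup>2)
    = real Q * (\<Sum>n<Q. (cmod (b n))\<^sup>2)"
proof -
  let ?e = "\<lambda>j n. cis (2 * pi * real j * real n / real Q)"
  have orth: "(\<Sum>j<Q. ?e j n * cnj (?e j m)) = (if n = m then of_nat Q else 0)"
    if "n < Q" "m < Q" for n m
  proof -
    have "?e j n * cnj (?e j m) = cis (2 * pi * real j * of_int (int n - int m) / real Q)" for j
      by (simp add: cis_cnj cis_mult cis_divide[symmetric] diff_divide_distrib algebra_simps)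
    moreover have "\<not> int Q dvd int n - int m" if "n \<noteq> m"
      using \<open>n < Q\<close> \<open>m < Q\<close> that zdvd_imp_le[of "int Q" "\<bar>int n - int m\<bar>"] by auto
    ultimately show ?thesis using sum_cis_roots_eq_0[OF assms, of "int n - int m"] by auto
  qed
  have "complex_of_real (\<Sum>j<Q. (cmod (\<Sum>n<Q. b n * ?e j n))\<^sup>2)
      = (\<Sum>j<Q. (\<Sum>n<Q. b n * ?e j n) * (\<Sum>m<Q. cnj (b m) * cnj (?e j m)))"
    by (simp only: of_real_sum complex_norm_square cnj_sum complex_cnj_mult)
  also have "\<dots> = (\<Sum>j<Q. \<Sum>n<Q. \<Sum>m<Q. b n * cnj (b m) * (?e j n * cnj (?e j m)))"
    by (simp only: sum_product mult_ac)
  also have "\<dots> = (\<Sum>n<Q. \<Sum>m<Q. \<Sum>j<Q. b n * cnj (b m) * (?e j n * cnj (?e j m)))"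
    by (rule trans[OF sum.swap]) (rule sum.cong[OF refl], rule sum.swap)
  also have "\<dots> = (\<Sum>n<Q. \<Sum>m<Q. b n * cnj (b m) * (if n = m then of_nat Q else 0))"
    by (simp only: sum_distrib_left[symmetric], intro sum.cong refl) (simp add: orth)
  also have "\<dots> = (\<Sum>n<Q. b n * cnj (b n) * of_nat Q)"
    by (intro sum.cong refl) (simp add: if_distrib cong: if_cong)
  also have "\<dots> = complex_of_real (real Q * (\<Sum>n<Q. (cmod (b n))\<^sup>2))"
    by (simp add: complex_norm_square[symmetric] sum_distrib_left mult_ac)
  finally show ?thesis by (simp only: of_real_eq_iff)
qed

lemma bij_betw_add_mod:
  fixes Q v :: nat
  assumes "Q > 0"
  shows "bij_betw (\<lambda>m. (m + v) mod Q) {..<Q} {..<Q}"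
proof -
  have "inj_on (\<lambda>m. (m + v) mod Q) {..<Q}"
  proof (rule inj_onI)
    fix x y assume "x \<in> {..<Q}" "y \<in> {..<Q}" "(x + v) mod Q = (y + v) mod Q"
    then have "int (x + v) mod int Q = int (y + v) mod int Q"
      by (metis zmod_int)
    then have "int Q dvd int x - int y"
      by (simp add: mod_eq_dvd_iff)
    then show "x = y"
      using \<open>x \<in> {..<Q}\<close> \<open>y \<in> {..<Q}\<close> zdvd_imp_le[of "int Q" "\<bar>int x - int y\<bar>"]
      by (cases "x = y") auto
  qed
  then show ?thesis
    using assms by (intro bij_betw_imageI endo_inj_surj) auto
qed

text \<open>Viewed on the integers modulo \<open>Q\<close>, the weighted sum of shifts is a
  convolution operator. The Fourier transform turns it into multiplication by values of the
  exponential polynomial, each at most \<open>B\<close> in modulus, so Parseval gives the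
  bound.\<close>

lemma transference_inequality:
  fixes \<theta> a :: "nat \<Rightarrow> complex" and u :: "nat \<Rightarrow> nat"
  assumes u: "\<And>k. k < N \<Longrightarrow> u k \<le> D"
    and B: "\<And>\<alpha>::real. cmod (\<Sum>k<N. \<theta> k * cis (2 * pi * \<alpha> * real (u k))) \<le> B"
  shows "(\<Sum>m<L. (cmod (\<Sum>k<N. \<theta> k * a (m + u k)))\<^sup>2) \<le> B\<^sup>2 * (\<Sum>n<L + D. (cmod (a n))\<^sup>2)"
proof (cases "L = 0")
  case True
  then show ?thesis by (simp add: sum_nonneg)
next
  case False
  \<comment> \<open>The period is long enough that \<open>m + u k\<close> does not wrap around for
    \<open>m < L\<close>; there \<open>b\<close> agrees with the original sum.\<close>
  define Q where "Q = L + D"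
  have Q: "Q > 0" using False by (simp add: Q_def)
  let ?e = "\<lambda>j n. cis (2 * pi * real j * real n / real Q)"
  define b where "b m = (\<Sum>k<N. \<theta> k * a ((m + u k) mod Q))" for m
  have e_mod: "?e j (n mod Q) = ?e j n" for j n
  proof -
    have "real n = real (n mod Q) + real Q * real (n div Q)"
      by (metis mod_mult_div_eq of_nat_add of_nat_mult)
    then have "2 * pi * real j * real n / real Q
        = 2 * pi * real j * real (n mod Q) / real Q + 2 * pi * real (j * (n div Q))"
      using Q by (simp add: field_simps)
    then show ?thesis
      using cis_multiple_2pi[of "real (j * (n div Q))"] by (simp add: cis_mult[symmetric] del: of_nat_mult)
  qed
  have shift: "(\<Sum>m<Q. a ((m + v) mod Q) * ?e j m) = cis (- (2 * pi * real j * real v / real Q)) * (\<Sum>n<Q. a n * ?e j n)"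
    for j v
  proof -
    have "(\<Sum>n<Q. a n * ?e j n) = (\<Sum>m<Q. a ((m + v) mod Q) * ?e j ((m + v) mod Q))"
      by (rule sum.reindex_bij_betw[OF bij_betw_add_mod[OF Q], symmetric])
    also have "\<dots> = (\<Sum>m<Q. a ((m + v) mod Q) * ?e j (m + v))"
      by (simp only: e_mod)
    finally show ?thesis
      by (simp add: sum_distrib_left cis_mult mult.left_commute add_divide_distrib algebra_simps)
  qed
  \<comment> \<open>Each shift contributes only a phase; together the phases form the exponential
    polynomial at frequency \<open>- real j / real Q\<close>.\<close>
  have hat: "(\<Sum>m<Q. b m * ?e j m)
      = (\<Sum>k<N. \<theta> k * cis (2 * pi * (- real j / real Q) * real (u k))) * (\<Sum>n<Q. a n * ?e j n)" for j
  proof -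
    have "(\<Sum>m<Q. b m * ?e j m) = (\<Sum>k<N. \<theta> k * (\<Sum>m<Q. a ((m + u k) mod Q) * ?e j m))"
      unfolding b_def sum_distrib_right sum_distrib_left by (subst sum.swap) (simp only: mult.assoc)
    then show ?thesis unfolding shift by (simp add: sum_distrib_right mult.assoc)
  qed
  have "real Q * (\<Sum>m<Q. (cmod (b m))\<^sup>2) \<le> B\<^sup>2 * (real Q * (\<Sum>n<Q. (cmod (a n))\<^sup>2))"
    unfolding finite_Parseval[OF Q, symmetric] hat norm_mult power_mult_distrib
    by (subst sum_distrib_left) (intro sum_mono mult_right_mono power_mono B, auto)
  then have *: "(\<Sum>m<Q. (cmod (b m))\<^sup>2) \<le> B\<^sup>2 * (\<Sum>n<Q. (cmod (a n))\<^sup>2)"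
    using Q by (simp add: mult.left_commute)
  have "(\<Sum>m<L. (cmod (\<Sum>k<N. \<theta> k * a (m + u k)))\<^sup>2) = (\<Sum>m<L. (cmod (b m))\<^sup>2)"
  proof (intro sum.cong refl)
    fix m assume "m \<in> {..<L}"
    then have "m + u k < Q" if "k < N" for k using u[OF that] by (simp add: Q_def)
    then show "(cmod (\<Sum>k<N. \<theta> k * a (m + u k)))\<^sup>2 = (cmod (b m))\<^sup>2" by (simp add: b_def)
  qed
  also have "\<dots> \<le> (\<Sum>m<Q. (cmod (b m))\<^sup>2)" by (rule sum_mono2) (auto simp: Q_def)
  finally show ?thesis using * by (simp add: Q_def)
qed

section \<open>Second moments of sums along an orbit\<close>

lemma (in dynamical_system) measurable_T_funpow [measurable]: "T ^^ n \<in> measurable M M"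
  using measurable_T by (rule measurable_compose_n)

lemma (in dynamical_system) nn_integral_T_funpow:
  assumes [measurable]: "g \<in> borel_measurable M"
  shows "(\<integral>\<^sup>+x. g ((T ^^ n) x) \<partial>M) = (\<integral>\<^sup>+x. g x \<partial>M)"
proof (induction n)
  case (Suc n)
  note measurable_T [measurable]
  have "distr M M T = M"
    by (rule measure_eqI) (auto simp: emeasure_distr invariant_T measurable_T)
  then have "(\<integral>\<^sup>+x. g ((T ^^ n) x) \<partial>M) = (\<integral>\<^sup>+x. g ((T ^^ n) x) \<partial>distr M M T)" by simp
  also have "\<dots> = (\<integral>\<^sup>+x. g ((T ^^ Suc n) x) \<partial>M)"
    by (simp add: nn_integral_distr funpow_swap1)
  finally show ?case using Suc by simp
qed simp

text \<open>The spectral theorem is avoided: apply the transference inequality along orbit segments of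
  length \<open>L\<close>, integrate, and let \<open>L \<rightarrow> \<infinity>\<close>.\<close>

lemma (in dynamical_system) nn_integral_weighted_sum_le:
  fixes f :: "'a \<Rightarrow> complex" and u :: "nat \<Rightarrow> nat"
  assumes [measurable]: "f \<in> borel_measurable M"
    and F: "(\<integral>\<^sup>+x. ennreal ((cmod (f x))\<^sup>2) \<partial>M) = ennreal F" "F \<ge> 0"
    and u: "\<And>k. k < N \<Longrightarrow> u k \<le> D"
    and B: "\<And>\<alpha>::real. cmod (\<Sum>k<N. \<theta> k * cis (2 * pi * \<alpha> * real (u k))) \<le> B"
  shows "(\<integral>\<^sup>+x. ennreal ((cmod (\<Sum>k<N. \<theta> k * f ((T ^^ u k) x)))\<^sup>2) \<partial>M) \<le> ennreal (B\<^sup>2 * F)"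
proof -
  define S where "S x = (\<Sum>k<N. \<theta> k * f ((T ^^ u k) x))" for x
  have [measurable]: "S \<in> borel_measurable M" unfolding S_def by measurable
  define I where "I = (\<integral>\<^sup>+x. ennreal ((cmod (S x))\<^sup>2) \<partial>M)"
  \<comment> \<open>By invariance the \<open>L\<close> translates of \<open>S\<close> along the
    orbit have the same second moment \<open>I\<close>. For fixed \<open>x\<close> their squares are
    summed by transference with \<open>a n = f ((T ^^ n) x)\<close>.\<close>
  have main: "of_nat L * I \<le> ennreal (B\<^sup>2 * (real (L + D) * F))" for L
  proof -
    have "of_nat L * I = (\<Sum>m<L. \<integral>\<^sup>+x. ennreal ((cmod (S ((T ^^ m) x)))\<^sup>2) \<partial>M)"
      unfolding I_def by (subst nn_integral_T_funpow[where g="\<lambda>x. ennreal ((cmod (S x))\<^sup>2)"]) auto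
    also have "\<dots> = (\<integral>\<^sup>+x. ennreal (\<Sum>m<L. (cmod (\<Sum>k<N. \<theta> k * f ((T ^^ (m + u k)) x)))\<^sup>2) \<partial>M)"
      by (subst nn_integral_sum[symmetric])
        (auto simp: S_def sum_ennreal funpow_add add.commute[of _ "u _"] intro!: nn_integral_cong)
    also have "\<dots> \<le> (\<integral>\<^sup>+x. ennreal (B\<^sup>2 * (\<Sum>n<L + D. (cmod (f ((T ^^ n) x)))\<^sup>2)) \<partial>M)"
      by (intro nn_integral_mono ennreal_leI)
        (rule transference_inequality[where a="\<lambda>n. f ((T ^^ n) x)" and u=u and N=N for x], auto intro: u B)
    also have "\<dots> = ennreal (B\<^sup>2) * (\<Sum>n<L + D. \<integral>\<^sup>+x. ennreal ((cmod (f ((T ^^ n) x)))\<^sup>2) \<partial>M)"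
      by (simp add: ennreal_mult sum_nonneg nn_integral_cmult nn_integral_sum sum_ennreal[symmetric] del: sum_ennreal)
    also have "\<dots> = ennreal (B\<^sup>2) * (of_nat (L + D) * ennreal F)"
      by (subst nn_integral_T_funpow[where g="\<lambda>x. ennreal ((cmod (f x))\<^sup>2)"]) (auto simp: F)
    also have "\<dots> = ennreal (B\<^sup>2 * (real (L + D) * F))"
      using F(2) by (simp add: ennreal_mult ennreal_of_nat_eq_real_of_nat)
    finally show ?thesis .
  qed
  \<comment> \<open>Finiteness, already visible at \<open>L = 1\<close>, allows division by
    \<open>L\<close> in the reals.\<close>
  have "I \<noteq> \<infinity>" using main[of 1] by (auto simp: top_unique)
  then obtain s where s: "I = ennreal s" "s \<ge> 0" by (cases I) auto
  \<comment> \<open>The \<open>D\<close> extra orbit points cost a fixed amount, which becomes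
    negligible after division by \<open>L\<close>.\<close>
  have "s \<le> B\<^sup>2 * F + B\<^sup>2 * real D * F / real L" if "L \<ge> 1" for L
  proof -
    have "real L * s \<le> B\<^sup>2 * (real (L + D) * F)"
      using main[of L] s F(2)
      by (simp add: ennreal_of_nat_eq_real_of_nat ennreal_mult[symmetric] ennreal_le_iff)
    then show ?thesis using that by (simp add: field_simps)
  qed
  moreover have "(\<lambda>L. B\<^sup>2 * F + B\<^sup>2 * real D * F / real L) \<longlonglongrightarrow> B\<^sup>2 * F + 0"
    by (intro tendsto_intros lim_const_over_n)
  ultimately have "s \<le> B\<^sup>2 * F"
    by (intro LIMSEQ_le_const) auto
  then show ?thesis using s F(2) by (simp add: I_def[symmetric] S_def[symmetric] ennreal_leI)
qed


text \<open>Cauchy-Schwarz and invariance, with no cancellation. Having the absolute values inside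
  the sum controls all partial sums of a block at once, in place of a maximal inequality.\<close>

lemma (in dynamical_system) nn_integral_block_sum_le:
  fixes f :: "'a \<Rightarrow> complex" and u :: "nat \<Rightarrow> nat"
  assumes [measurable]: "f \<in> borel_measurable M"
    and F: "(\<integral>\<^sup>+x. ennreal ((cmod (f x))\<^sup>2) \<partial>M) = ennreal F" "F \<ge> 0"
  shows "(\<integral>\<^sup>+x. ennreal ((\<Sum>k\<in>A. cmod (f ((T ^^ u k) x)))\<^sup>2) \<partial>M) \<le> ennreal ((real (card A))\<^sup>2 * F)"
proof -
  have "(\<integral>\<^sup>+x. ennreal ((\<Sum>k\<in>A. cmod (f ((T ^^ u k) x)))\<^sup>2) \<partial>M)
      \<le> (\<integral>\<^sup>+x. ennreal (real (card A) * (\<Sum>k\<in>A. (cmod (f ((T ^^ u k) x)))\<^sup>2)) \<partial>M)"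
    by (intro nn_integral_mono ennreal_leI) (simp add: sum_squared_le_sum_of_squares mult.commute[of "real (card A)"])
  also have "\<dots> = ennreal (real (card A)) * (\<Sum>k\<in>A. \<integral>\<^sup>+x. ennreal ((cmod (f ((T ^^ u k) x)))\<^sup>2) \<partial>M)"
    by (simp add: ennreal_mult sum_nonneg nn_integral_cmult nn_integral_sum sum_ennreal[symmetric] del: sum_ennreal)
  also have "\<dots> = ennreal (real (card A)) * (of_nat (card A) * ennreal F)"
    by (subst nn_integral_T_funpow[where g="\<lambda>x. ennreal ((cmod (f x))\<^sup>2)"]) (auto simp: F)
  also have "\<dots> = ennreal ((real (card A))\<^sup>2 * F)"
    using F(2) by (simp add: ennreal_mult ennreal_of_nat_eq_real_of_nat power2_eq_square mult.assoc)
  finally show ?thesis .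
qed

section \<open>Almost everywhere convergence along blocks of polynomial growth\<close>

lemma AE_tendsto_0_if_summable_nn_integral:
  fixes g :: "nat \<Rightarrow> 'a \<Rightarrow> real"
  assumes [measurable]: "\<And>n. g n \<in> borel_measurable M"
    and nonneg: "\<And>n x. g n x \<ge> 0" "\<And>n. c n \<ge> 0"
    and le: "\<And>n. (\<integral>\<^sup>+x. ennreal (g n x) \<partial>M) \<le> ennreal (c n)"
    and c: "summable c"
  shows "AE x in M. (\<lambda>n. g n x) \<longlonglongrightarrow> 0"
proof -
  \<comment> \<open>A series with finite expectation is finite almost everywhere, and then its terms
    tend to 0.\<close>
  have "(\<integral>\<^sup>+x. (\<Sum>n. ennreal (g n x)) \<partial>M) = (\<Sum>n. \<integral>\<^sup>+x. ennreal (g n x) \<partial>M)"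
    by (rule nn_integral_suminf) simp
  also have "\<dots> \<le> (\<Sum>n. ennreal (c n))" by (intro suminf_le le summableI)
  also have "\<dots> = ennreal (suminf c)" using nonneg(2) c by (intro suminf_ennreal2)
  finally have "(\<integral>\<^sup>+x. (\<Sum>n. ennreal (g n x)) \<partial>M) \<noteq> \<infinity>" by (auto simp: top_unique)
  then have "AE x in M. (\<Sum>n. ennreal (g n x)) \<noteq> \<infinity>"
    by (intro nn_integral_PInf_AE) simp_all
  then show ?thesis
    by eventually_elim (auto intro!: summable_LIMSEQ_zero summable_suminf_not_top nonneg)
qed

lemma powr_square: "(x powr a)\<^sup>2 = x powr (2 * a)" for x a :: real
  by (simp add: power2_eq_square powr_add[symmetric])

lemma powr_diff_le:
  fixes x p :: real
  assumes "x \<ge> 1" "p \<ge> 1"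
  shows "(x + 1) powr p - x powr p \<le> p * 2 powr (p - 1) * x powr (p - 1)"
proof -
  have "\<exists>z. x < z \<and> z < x + 1 \<and> (x + 1) powr p - x powr p = (x + 1 - x) * (p * z powr (p - 1))"
    using assms by (intro MVT2) (auto intro!: derivative_eq_intros has_real_derivative_powr)
  then obtain z where z: "x < z" "z < x + 1" "(x + 1) powr p - x powr p = p * z powr (p - 1)" by auto
  \<comment> \<open>The mean value point satisfies \<open>z < x + 1 \<le> 2 * x\<close>, whence the
    factor \<open>2 powr (p - 1)\<close>.\<close>
  have "z powr (p - 1) \<le> (2 * x) powr (p - 1)"
    using z assms by (intro powr_mono2) auto
  then show ?thesis using z assms by (simp add: powr_mult mult.assoc mult_left_mono)
qed

text \<open>With rounding up, \<open>block_start p j \<le> N\<close> holds for a natural number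
  \<open>N\<close> exactly when \<open>real j powr p \<le> real N\<close>.\<close>

definition block_start :: "real \<Rightarrow> nat \<Rightarrow> nat" where
  "block_start p j = nat \<lceil>real j powr p\<rceil>"

lemma le_block_start: "real j powr p \<le> real (block_start p j)"
  unfolding block_start_def by linarith

lemma block_start_le:
  assumes "j \<ge> 1" "p \<ge> 0"
  shows "real (block_start p j) \<le> 2 * real j powr p"
proof -
  have "real j powr p \<ge> 1" using assms by (simp add: ge_one_powr_ge_zero)
  then show ?thesis unfolding block_start_def by linarith
qed

lemma block_length_le:
  assumes "j \<ge> 1" "p \<ge> 1"
  shows "real (block_start p (Suc j) - block_start p j) \<le> (p * 2 powr (p - 1) + 1) * real j powr (p - 1)"
proof -
  \<comment> \<open>This lets the error of at most 1 from rounding be absorbed as the summand 1 of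
    the constant.\<close>
  have "real j powr (p - 1) \<ge> 1" using assms by (simp add: ge_one_powr_ge_zero)
  moreover have "real (block_start p (Suc j) - block_start p j) \<le> (real j + 1) powr p - real j powr p + 1"
  proof -
    have "real j powr p \<le> (real j + 1) powr p" using assms by (intro powr_mono2) auto
    then show ?thesis unfolding block_start_def by (simp add: add.commute) linarith
  qed
  ultimately show ?thesis using powr_diff_le[of "real j" p] assms by (simp add: algebra_simps)
qed

text \<open>With \<open>j\<close> the integer part of \<open>N powr (1 / p)\<close>, the index
  \<open>N\<close> lies between the \<open>j\<close>-th and the next block start. So
  \<open>S N\<close> differs from its value at the former by at most the absolute block sum, while
  \<open>real N powr \<beta>\<close> is at least \<open>real j powr (p * \<beta>)\<close>. The
  hypotheses are on squares because second moments deliver them in that form.\<close>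

lemma tendsto_0_if_blocks_tendsto_0:
  fixes S :: "nat \<Rightarrow> complex" and a :: "nat \<Rightarrow> real" and p \<beta> :: real
  assumes p: "p > 0" and \<beta>: "\<beta> \<ge> 0"
    and S: "\<And>m n. m \<le> n \<Longrightarrow> cmod (S n - S m) \<le> (\<Sum>k=m..<n. a k)" and a: "\<And>k. a k \<ge> 0"
    and S_start: "(\<lambda>j. (cmod (S (block_start p j)) / real j powr (p * \<beta>))\<^sup>2) \<longlonglongrightarrow> 0"
    and gaps: "(\<lambda>j. ((\<Sum>k=block_start p j..<block_start p (Suc j). a k) / real j powr (p * \<beta>))\<^sup>2) \<longlonglongrightarrow> 0"
  shows "(\<lambda>N. 1 / of_real (real N powr \<beta>) * S N) \<longlonglongrightarrow> 0"
proof -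
  define h where "h j = cmod (S (block_start p j)) / real j powr (p * \<beta>)
    + (\<Sum>k=block_start p j..<block_start p (Suc j). a k) / real j powr (p * \<beta>)" for j
  have "h \<longlonglongrightarrow> 0 + 0"
    unfolding h_def
    using tendsto_real_sqrt[OF S_start] tendsto_real_sqrt[OF gaps]
    by (intro tendsto_add) (simp_all add: tendsto_rabs_zero_iff sum_nonneg a)
  moreover define J where "J N = nat \<lfloor>real N powr (1 / p)\<rfloor>" for N
  have "filterlim (\<lambda>N. real N powr (1 / p)) at_top sequentially"
    using p by real_asymp
  then have "filterlim J at_top sequentially"
    unfolding J_def
    by (intro filterlim_compose[OF filterlim_nat_sequentially] filterlim_compose[OF filterlim_floor_sequentially])
  ultimately have "(\<lambda>N. h (J N)) \<longlonglongrightarrow> 0" by (auto intro: filterlim_compose)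
  moreover have "\<forall>\<^sub>F N in sequentially. norm (1 / of_real (real N powr \<beta>) * S N) \<le> h (J N)"
    using eventually_ge_at_top[of 1]
  proof eventually_elim
    case (elim N)
    define j where "j = J N"
    have j: "real j \<le> real N powr (1 / p)" "real N powr (1 / p) < real (Suc j)"
      unfolding j_def J_def using powr_ge_zero[of "real N" "1/p"] by linarith+
    \<comment> \<open>The index \<open>j = 0\<close> must be excluded: \<open>h 0\<close> is 0 by
      the convention for division by zero, so it bounds nothing.\<close>
    have N1: "real N powr (1 / p) \<ge> 1" using elim p by (intro ge_one_powr_ge_zero) auto
    then have "j \<ge> 1" unfolding j_def J_def by linarith
    have N: "(real N powr (1 / p)) powr p = real N" using p elim by (simp add: powr_powr)
    have jN: "real j powr p \<le> real N"
      using powr_mono2[of p "real j", OF _ _ j(1)] p N by simp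
    have Nj: "real N < real (Suc j) powr p"
      using powr_less_mono2[of p "real N powr (1/p)", OF _ _ j(2)] p N by simp
    have 1: "block_start p j \<le> N"
      unfolding block_start_def using jN by (simp add: ceiling_le_iff nat_le_iff)
    have 2: "N \<le> block_start p (Suc j)"
      using Nj le_block_start[of "Suc j" p] by linarith
    have "cmod (S N) \<le> cmod (S (block_start p j)) + cmod (S N - S (block_start p j))"
      using norm_triangle_ineq[of "S (block_start p j)" "S N - S (block_start p j)"] by simp
    also have "cmod (S N - S (block_start p j)) \<le> (\<Sum>k=block_start p j..<N. a k)"
      by (rule S[OF 1])
    also have "\<dots> \<le> (\<Sum>k=block_start p j..<block_start p (Suc j). a k)"
      using 2 by (intro sum_mono2) (auto simp: a)
    finally have le: "cmod (S N) \<le> cmod (S (block_start p j)) + (\<Sum>k=block_start p j..<block_start p (Suc j). a k)"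
      by simp
    have "real j powr (p * \<beta>) \<le> real N powr \<beta>"
      using powr_mono2[OF \<beta> _ jN] by (simp add: powr_powr)
    moreover have "real j powr (p * \<beta>) > 0" using \<open>j \<ge> 1\<close> by simp
    moreover have "norm (1 / of_real (real N powr \<beta>) * S N) = cmod (S N) / real N powr \<beta>"
      by (simp add: norm_mult norm_divide)
    ultimately show ?case
      using le unfolding h_def j_def[symmetric] add_divide_distrib[symmetric]
      by (auto intro!: frac_le add_nonneg_nonneg sum_nonneg a)
  qed
  ultimately show ?thesis by (rule Lim_null_comparison[rotated])
qed

lemma (in dynamical_system) AE_weighted_averages_tendsto_0:
  fixes f :: "'a \<Rightarrow> complex" and \<theta> :: "nat \<Rightarrow> complex" and u :: "nat \<Rightarrow> nat"
  assumes f [measurable]: "f \<in> borel_measurable M"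
    and fin: "(\<integral>\<^sup>+x. ennreal ((cmod (f x))\<^sup>2) \<partial>M) < \<infinity>"
    and \<theta>: "\<And>k. cmod (\<theta> k) \<le> K"
    and u: "mono u"
    and \<delta>: "0 \<le> \<delta>" "\<delta> < 1" and \<beta>: "\<beta> > (1 + \<delta>) / 2"
    and bound: "\<And>N \<alpha>. N \<ge> 1 \<Longrightarrow>
      cmod (\<Sum>k<N. \<theta> k * cis (2 * pi * \<alpha> * real (u k))) \<le> C * real N powr \<delta>"
  shows "AE x in M. (\<lambda>N. 1 / of_real (real N powr \<beta>) * (\<Sum>k<N. \<theta> k * f ((T ^^ u k) x))) \<longlonglongrightarrow> 0"
proof -
  obtain F where F: "(\<integral>\<^sup>+x. ennreal ((cmod (f x))\<^sup>2) \<partial>M) = ennreal F" "F \<ge> 0"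
    using fin by (cases "\<integral>\<^sup>+x. ennreal ((cmod (f x))\<^sup>2) \<partial>M") auto
  have K: "K \<ge> 0" using \<theta>[of 0] norm_ge_zero order_trans by blast
  \<comment> \<open>This exponent balances the two estimates: \<open>p * \<delta>\<close> is the
    growth of the bound on \<open>S\<close> at block starts, \<open>p - 1\<close> that of the block
    lengths, and they coincide.\<close>
  define p where "p = 1 / (1 - \<delta>)"
  have p: "p \<ge> 1" using \<delta> by (simp add: p_def field_simps)
  have p\<delta>: "p * \<delta> = p - 1" using \<delta> by (simp add: p_def field_simps)
  \<comment> \<open>Equivalent to \<open>?s < -1\<close> below, which makes both series of second
    moments converge.\<close>
  have p\<beta>: "2 * (p * \<beta>) > 2 * p - 1"
  proof -
    have "p * (2 * \<beta>) > p * (1 + \<delta>)" using \<beta> p by (intro mult_strict_left_mono) auto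
    then show ?thesis using p\<delta> by (simp add: algebra_simps)
  qed
  define S where "S N x = (\<Sum>k<N. \<theta> k * f ((T ^^ u k) x))" for N x
  define a where "a k x = K * cmod (f ((T ^^ u k) x))" for k x
  let ?s = "2 * (p - 1) - 2 * (p * \<beta>)"
  let ?N = "block_start p"
  have meas [measurable]: "S N \<in> borel_measurable M" "a N \<in> borel_measurable M" for N
    unfolding S_def a_def by measurable
  have summ: "summable (\<lambda>j. c * real j powr ?s)" for c
    using p\<beta> by (intro summable_mult) (simp add: summable_real_powr_iff)
  have sq: "ennreal ((y / real j powr (p * \<beta>))\<^sup>2) = ennreal (real j powr (- 2 * (p * \<beta>))) * ennreal (y\<^sup>2)" for y j
    by (simp add: power_divide powr_square ennreal_mult[symmetric] powr_minus_divide)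
  have powr_split: "real j powr ?s = real j powr (- 2 * (p * \<beta>)) * real j powr (2 * (p - 1))" for j
    by (simp add: powr_add[symmetric])
  have ae1: "AE x in M. (\<lambda>j. (cmod (S (?N j) x) / real j powr (p * \<beta>))\<^sup>2) \<longlonglongrightarrow> 0"
  proof (rule AE_tendsto_0_if_summable_nn_integral[OF _ _ _ _ summ])
    fix j
    show "(\<integral>\<^sup>+x. ennreal ((cmod (S (?N j) x) / real j powr (p * \<beta>))\<^sup>2) \<partial>M)
      \<le> ennreal ((C\<^sup>2 * 2 powr (2 * \<delta>) * F) * real j powr ?s)"
    \<comment> \<open>At \<open>j = 0\<close> the quotient is 0 because its denominator is
      0.\<close>
    proof (cases "j = 0")
      case False
      then have j: "j \<ge> 1" by simp
      have N: "?N j \<ge> 1"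
        using le_block_start[of j p] j ge_one_powr_ge_zero[of "real j" p] p by linarith
      have "(C * real (?N j) powr \<delta>)\<^sup>2 = C\<^sup>2 * real (?N j) powr (2 * \<delta>)"
        by (simp add: power_mult_distrib powr_square)
      \<comment> \<open>Monotonicity of the power in its base relies on
        \<open>\<delta> \<ge> 0\<close>.\<close>
      also have "\<dots> \<le> C\<^sup>2 * (2 * real j powr p) powr (2 * \<delta>)"
        using block_start_le[OF j] p \<delta> by (intro mult_left_mono powr_mono2) auto
      also have "\<dots> = C\<^sup>2 * 2 powr (2 * \<delta>) * real j powr (2 * (p - 1))"
        unfolding p\<delta>[symmetric] by (simp add: powr_mult powr_powr mult_ac)
      finally have B: "(C * real (?N j) powr \<delta>)\<^sup>2 * F \<le> C\<^sup>2 * 2 powr (2 * \<delta>) * real j powr (2 * (p - 1)) * F"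
        using F(2) by (rule mult_right_mono)
      have "(\<integral>\<^sup>+x. ennreal ((cmod (S (?N j) x) / real j powr (p * \<beta>))\<^sup>2) \<partial>M)
        = ennreal (real j powr (- 2 * (p * \<beta>))) * (\<integral>\<^sup>+x. ennreal ((cmod (S (?N j) x))\<^sup>2) \<partial>M)"
        unfolding sq by (rule nn_integral_cmult) measurable
      also have "\<dots> \<le> ennreal (real j powr (- 2 * (p * \<beta>))) * ennreal ((C * real (?N j) powr \<delta>)\<^sup>2 * F)"
        unfolding S_def
        by (intro mult_left_mono nn_integral_weighted_sum_le[where D="u (?N j)", OF f F] bound N monoD[OF u]) auto
      also have "\<dots> \<le> ennreal (real j powr (- 2 * (p * \<beta>))) * ennreal (C\<^sup>2 * 2 powr (2 * \<delta>) * real j powr (2 * (p - 1)) * F)"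
        by (intro mult_left_mono ennreal_leI B) auto
      also have "\<dots> = ennreal ((C\<^sup>2 * 2 powr (2 * \<delta>) * F) * real j powr ?s)"
        using F(2) unfolding powr_split by (simp add: ennreal_mult[symmetric] mult_ac)
      finally show ?thesis .
    qed simp
  qed (use F(2) in auto)
  have ae2: "AE x in M. (\<lambda>j. ((\<Sum>k=?N j..<?N (Suc j). a k x) / real j powr (p * \<beta>))\<^sup>2) \<longlonglongrightarrow> 0"
  proof (rule AE_tendsto_0_if_summable_nn_integral[OF _ _ _ _ summ])
    fix j
    let ?c = "p * 2 powr (p - 1) + 1"
    show "(\<integral>\<^sup>+x. ennreal (((\<Sum>k=?N j..<?N (Suc j). a k x) / real j powr (p * \<beta>))\<^sup>2) \<partial>M)
      \<le> ennreal ((K\<^sup>2 * ?c\<^sup>2 * F) * real j powr ?s)"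
    proof (cases "j = 0")
      case False
      then have j: "j \<ge> 1" by simp
      have "(real (?N (Suc j) - ?N j))\<^sup>2 \<le> (?c * real j powr (p - 1))\<^sup>2"
        using block_length_le[OF j p] by (intro power_mono) auto
      then have B: "(real (?N (Suc j) - ?N j))\<^sup>2 * F \<le> ?c\<^sup>2 * real j powr (2 * (p - 1)) * F"
        using F(2) by (intro mult_right_mono) (auto simp: power_mult_distrib powr_square)
      have K_sq: "ennreal ((\<Sum>k=?N j..<?N (Suc j). a k x)\<^sup>2)
        = ennreal (K\<^sup>2) * ennreal ((\<Sum>k=?N j..<?N (Suc j). cmod (f ((T ^^ u k) x)))\<^sup>2)" for x
        unfolding a_def by (simp add: sum_distrib_left[symmetric] power_mult_distrib ennreal_mult)
      have "(\<integral>\<^sup>+x. ennreal (((\<Sum>k=?N j..<?N (Suc j). a k x) / real j powr (p * \<beta>))\<^sup>2) \<partial>M)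
        = ennreal (real j powr (- 2 * (p * \<beta>))) * (ennreal (K\<^sup>2) *
          (\<integral>\<^sup>+x. ennreal ((\<Sum>k=?N j..<?N (Suc j). cmod (f ((T ^^ u k) x)))\<^sup>2) \<partial>M))"
        unfolding sq K_sq by (simp add: nn_integral_cmult)
      also have "\<dots> \<le> ennreal (real j powr (- 2 * (p * \<beta>))) * (ennreal (K\<^sup>2) *
          ennreal ((real (?N (Suc j) - ?N j))\<^sup>2 * F))"
        using nn_integral_block_sum_le[OF f F, of u "{?N j..<?N (Suc j)}"] by (intro mult_left_mono) auto
      also have "\<dots> \<le> ennreal (real j powr (- 2 * (p * \<beta>))) * (ennreal (K\<^sup>2) *
          ennreal (?c\<^sup>2 * real j powr (2 * (p - 1)) * F))"
        by (intro mult_left_mono ennreal_leI B) auto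
      also have "\<dots> = ennreal ((K\<^sup>2 * ?c\<^sup>2 * F) * real j powr ?s)"
        using F(2) unfolding powr_split by (simp add: ennreal_mult[symmetric] mult_ac)
      finally show ?thesis .
    qed simp
  qed (use F(2) in auto)
  from ae1 ae2 have "AE x in M. (\<lambda>N. 1 / of_real (real N powr \<beta>) * S N x) \<longlonglongrightarrow> 0"
  proof eventually_elim
    case (elim x)
    show ?case
    proof (rule tendsto_0_if_blocks_tendsto_0[OF _ _ _ _ elim])
      fix m n :: nat assume "m \<le> n"
      then have "S n x - S m x = (\<Sum>k=m..<n. \<theta> k * f ((T ^^ u k) x))"
        unfolding S_def by (simp add: sum_diff_nat_ivl lessThan_atLeast0)
      then show "cmod (S n x - S m x) \<le> (\<Sum>k=m..<n. a k x)"
        unfolding a_def by (auto simp: norm_mult intro!: sum_norm_le mult_right_mono \<theta>)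
    qed (use p \<beta> \<delta> K in \<open>auto simp: a_def\<close>)
  qed
  then show ?thesis by (simp add: S_def)
qed

section \<open>Vanishing of the weights for negative exponents\<close>

text \<open>Each weight is a Fourier coefficient of the exponential polynomial, hence bounded by its
  supremum. Transference stands in for integration against a character.\<close>

lemma weights_eq_0_if_bound_tendsto_0:
  fixes \<theta> :: "nat \<Rightarrow> complex" and u :: "nat \<Rightarrow> nat"
  assumes u: "strict_mono u"
    and bound: "\<And>N \<alpha>. N \<ge> 1 \<Longrightarrow> cmod (\<Sum>k<N. \<theta> k * cis (2 * pi * \<alpha> * real (u k))) \<le> B N"
    and B: "B \<longlonglongrightarrow> 0"
  shows "\<theta> n = 0"
proof -
  have le: "cmod (\<theta> n) \<le> B N" if N: "N \<ge> Suc n" for N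
  proof -
    \<comment> \<open>The point mass at \<open>u n\<close> isolates \<open>\<theta> n\<close>, since
      \<open>u\<close> is injective; transference is applied to it with the single starting point
      0.\<close>
    let ?a = "\<lambda>m. if m = u n then 1 else 0 :: complex"
    have u_le: "u k \<le> u N" if "k < N" for k
      using strict_monoD[OF u that] by simp
    have B0: "B N \<ge> 0" using order_trans[OF norm_ge_zero bound[of N 0]] N by simp
    have "(\<Sum>k<N. \<theta> k * ?a (0 + u k)) = (\<Sum>k<N. if k = n then \<theta> k else 0)"
      using u by (intro sum.cong refl) (auto simp: strict_mono_eq)
    also have "\<dots> = \<theta> n" using N by simp
    finally have "(cmod (\<theta> n))\<^sup>2 = (\<Sum>m<1. (cmod (\<Sum>k<N. \<theta> k * ?a (m + u k)))\<^sup>2)" by simp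
    also have "\<dots> \<le> (B N)\<^sup>2 * (\<Sum>m<1 + u N. (cmod (?a m))\<^sup>2)"
      using N by (intro transference_inequality u_le bound) auto
    also have "(\<Sum>m<1 + u N. (cmod (?a m))\<^sup>2) = (\<Sum>m<1 + u N. if m = u n then 1 else 0)"
      by (intro sum.cong) auto
    also have "\<dots> = 1" using u_le[of n] N by simp
    finally have "(cmod (\<theta> n))\<^sup>2 \<le> (B N)\<^sup>2" by simp
    then show ?thesis using B0 by (rule power2_le_imp_le)
  qed
  have "cmod (\<theta> n) \<le> 0"
    using le by (intro LIMSEQ_le_const[OF B]) blast
  then show ?thesis by simp
qed

section \<open>Deduction of both claims\<close>

theorem theorem1:
  fixes \<theta> :: "nat \<Rightarrow> complex" and u :: "nat \<Rightarrow> nat" and \<delta> C :: real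
  assumes "bounded (range \<theta>)"
    and "strict_mono u"
    and "\<delta> < 1"
    and "\<And>N::nat. N \<ge> 1 \<Longrightarrow>
      (SUP \<alpha>::real. cmod (\<Sum>k<N. \<theta> k * exp (2 * \<i> * of_real pi * of_real \<alpha> * of_nat (u k))))
        \<le> C * real N powr \<delta>"
  shows "(\<forall>(M :: 'a measure) T. dynamical_system M T \<longrightarrow>
      (\<forall>f \<in> Lp 2 M.
        measure M {x \<in> space M.
          (\<lambda>N::nat. 1 / of_nat N * (\<Sum>k<N. \<theta> k * f ((T ^^ u k) x))) \<longlonglongrightarrow> 0} = 1))
    \<and> (\<forall>(M :: 'a measure) T. dynamical_system M T \<longrightarrow>
      (\<forall>\<epsilon>>0. \<forall>f \<in> Lp (2 + \<epsilon>) M. \<forall>\<beta>::real. \<beta> > (\<delta> + 2) / 3 \<longrightarrow>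
        measure M {x \<in> space M.
          (\<lambda>N::nat. 1 / of_real (real N powr \<beta>) * (\<Sum>k<N. \<theta> k * f ((T ^^ u k) x))) \<longlonglongrightarrow> 0} = 1))"
proof -
  obtain K where K: "\<And>k. cmod (\<theta> k) \<le> K"
    using assms(1) by (auto simp: bounded_iff)
  have bound: "cmod (\<Sum>k<N. \<theta> k * cis (2 * pi * \<alpha> * real (u k))) \<le> C * real N powr \<delta>"
    if "N \<ge> 1" for N \<alpha>
  proof -
    let ?P = "\<lambda>\<alpha>::real. cmod (\<Sum>k<N. \<theta> k * exp (2 * \<i> * of_real pi * of_real \<alpha> * of_nat (u k)))"
    have P: "?P \<alpha> = cmod (\<Sum>k<N. \<theta> k * cis (2 * pi * \<alpha> * real (u k)))" for \<alpha>
      by (simp add: cis_conv_exp mult_ac)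
    \<comment> \<open>A real \<open>SUP\<close> dominates its members only if the set is bounded
      above; bounded weights ensure this.\<close>
    have "?P \<alpha> \<le> (\<Sum>k<N. K)" for \<alpha>
      unfolding P by (rule sum_norm_le) (simp add: norm_mult K)
    then have "bdd_above (range ?P)" by (intro bdd_aboveI) auto
    then have "?P \<alpha> \<le> (SUP \<alpha>. ?P \<alpha>)" by (rule cSUP_upper[OF UNIV_I])
    also have "\<dots> \<le> C * real N powr \<delta>" by (rule assms(4)[OF that])
    finally show ?thesis unfolding P .
  qed
  have main: "measure M {x \<in> space M.
      (\<lambda>N::nat. 1 / of_real (real N powr \<beta>) * (\<Sum>k<N. \<theta> k * f ((T ^^ u k) x))) \<longlonglongrightarrow> 0} = 1"
    if "dynamical_system M T" and [measurable]: "f \<in> borel_measurable M"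
      and fin: "(\<integral>\<^sup>+x. ennreal ((cmod (f x))\<^sup>2) \<partial>M) < \<infinity>" and \<beta>: "\<beta> > (1 + \<delta>) / 2"
    for M :: "'a measure" and T f \<beta>
  proof -
    interpret dynamical_system M T by fact
    have "AE x in M. (\<lambda>N::nat. 1 / of_real (real N powr \<beta>) * (\<Sum>k<N. \<theta> k * f ((T ^^ u k) x))) \<longlonglongrightarrow> 0"
    proof (cases "\<delta> < 0")
      case True
      have "(\<lambda>N. C * real N powr \<delta>) \<longlonglongrightarrow> C * 0"
        using True by (intro tendsto_mult tendsto_const tendsto_neg_powr filterlim_real_sequentially)
      then have "\<theta> n = 0" for n
        using weights_eq_0_if_bound_tendsto_0[OF assms(2) bound] by simp
      then show ?thesis by simp
    next
      case False
      then show ?thesis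
        using AE_weighted_averages_tendsto_0[of f \<theta> K u \<delta> \<beta> C] fin K bound assms \<beta>
        by (simp add: strict_mono_mono)
    qed
    then show ?thesis by (subst prob_Collect_eq_1) auto
  qed
  show ?thesis
  proof (intro conjI allI impI ballI)
    fix M :: "'a measure" and T f assume dyn: "dynamical_system M T" and f: "f \<in> Lp 2 M"
    have "(\<integral>\<^sup>+x. ennreal ((cmod (f x))\<^sup>2) \<partial>M) < \<infinity>"
      using f by (auto simp: Lp_def less_top dest!: integrableD(2))
    \<comment> \<open>The exponent \<open>\<beta> = 1\<close> is admissible, as
      \<open>(1 + \<delta>) / 2 < 1\<close>.\<close>
    with main[OF dyn _ _, of f 1] f \<open>\<delta> < 1\<close>
    show "measure M {x \<in> space M.
        (\<lambda>N::nat. 1 / of_nat N * (\<Sum>k<N. \<theta> k * f ((T ^^ u k) x))) \<longlonglongrightarrow> 0} = 1"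
      by (simp add: Lp_def)
  next
    fix M :: "'a measure" and T f and \<epsilon> \<beta> :: real
    assume dyn: "dynamical_system M T" and "\<epsilon> > 0" and f: "f \<in> Lp (2 + \<epsilon>) M" and \<beta>: "\<beta> > (\<delta> + 2) / 3"
    interpret dynamical_system M T by fact
    have [measurable]: "f \<in> borel_measurable M" and int: "integrable M (\<lambda>x. cmod (f x) powr (2 + \<epsilon>))"
      using f by (auto simp: Lp_def)
    \<comment> \<open>Gives the inclusion of L^(2+\<epsilon>) in L^2, the constant 1 being
      integrable for a probability measure.\<close>
    have le: "y\<^sup>2 \<le> 1 + y powr (2 + \<epsilon>)" if "y \<ge> 0" for y :: real
    proof (cases "y \<le> 1")
      case True
      then show ?thesis using that power_le_one[of y 2] by (simp add: add_increasing2)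
    next
      case False
      then show ?thesis using powr_mono[of 2 "2 + \<epsilon>" y] \<open>\<epsilon> > 0\<close> by (simp add: powr_numeral)
    qed
    have "integrable M (\<lambda>x. 1 + cmod (f x) powr (2 + \<epsilon>))" using int by simp
    then have "integrable M (\<lambda>x. (cmod (f x))\<^sup>2)"
      by (rule Bochner_Integration.integrable_bound) (auto intro!: AE_I2 le)
    then have "(\<integral>\<^sup>+x. ennreal ((cmod (f x))\<^sup>2) \<partial>M) < \<infinity>"
      by (auto simp: less_top dest!: integrableD(2))
    \<comment> \<open>The two thresholds differ by \<open>(1 - \<delta>) / 6 > 0\<close>.\<close>
    moreover have "\<beta> > (1 + \<delta>) / 2" using \<beta> \<open>\<delta> < 1\<close> by (simp add: field_simps)
    ultimately show "measure M {x \<in> space M.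
        (\<lambda>N::nat. 1 / of_real (real N powr \<beta>) * (\<Sum>k<N. \<theta> k * f ((T ^^ u k) x))) \<longlonglongrightarrow> 0} = 1"
      by (intro main dyn) auto
  qed
qed

end
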